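(* For all $a, x \in \mathbb{O}$, $$\overrightarrow{ax} = \omega(a)\,\overrightarrow{x}.$$
   Context: $\mathbb{H}$ is the real quaternion algebra with basis $1,i,j,k$, $i^2=j^2=k^2=ijk=-1$, and conjugation $q\mapsto\overline{q}$. The real octonion algebra $\mathbb{O}$ consists of elements $a=a'+a''e$ with $a',a''\in\mathbb{H}$, with componentwise addition and product $(a'+a''e)(b'+b''e)=(a'b'-\overline{b''}a'')+(b''a'+a''\overline{b'})e$. Its canonical basis is $e_0=1,\ e_1=i,\ e_2=j,\ e_3=k,\ e_4=e,\ e_5=ie,\ e_6=je,\ e_7=ke$. For $x=x_0+x_1e_1+\cdots+x_7e_7\in\mathbb{O}$ with real $x_0,\dots,x_7$, put $\overrightarrow{x}=[x_0,x_1,\dots,x_7]^T\in\mathbb{R}^{8}$. For $q=q_0+q_1i+q_2j+q_3k\in\mathbb{H}$ put $$\phi(q)=\begin{bmatrix} q_0&-q_1&-q_2&-q_3\\ q_1&q_0&-q_3&q_2\\ q_2&q_3&q_0&-q_1\\ q_3&-q_2&q_1&q_0\end{bmatrix},\quad \tau(q)=\begin{bmatrix} q_0&-q_1&-q_2&-q_3\\ q_1&q_0&q_3&-q_2\\ q_2&-q_3&q_0&q_1\\ q_3&q_2&-q_1&q_0\end{bmatrix},$$ and $K_4=\mathrm{diag}(1,-1,-1,-1)$. For $a=a'+a''e\in\mathbb{O}$, the left matrix representation is the $8\times 8$ real matrix $$\omega(a)=\begin{bmatrix}\phi(a') & -\tau(a'')K_4\\ \phi(a'')K_4&\tau(a')\end{bmatrix}.$$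 *)

theory Defs
  imports Complex_Main "Jordan_Normal_Form.Matrix"
begin

subsection \<open>The real quaternion algebra\<close>

datatype quat = Quat (q0: real) (q1: real) (q2: real) (q3: real)

lemma quat_eq_iff: "p = q \<longleftrightarrow> q0 p = q0 q \<and> q1 p = q1 q \<and> q2 p = q2 q \<and> q3 p = q3 q"
  by (cases p; cases q) auto

instantiation quat :: real_algebra_1
begin

definition zero_quat :: quat where
  "0 = Quat 0 0 0 0"

definition one_quat :: quat where
  "1 = Quat 1 0 0 0"

definition plus_quat :: "quat \<Rightarrow> quat \<Rightarrow> quat" where
  "p + q = Quat (q0 p + q0 q) (q1 p + q1 q) (q2 p + q2 q) (q3 p + q3 q)"

definition uminus_quat :: "quat \<Rightarrow> quat" where
  "- p = Quat (- q0 p) (- q1 p) (- q2 p) (- q3 p)"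

definition minus_quat :: "quat \<Rightarrow> quat \<Rightarrow> quat" where
  "p - q = Quat (q0 p - q0 q) (q1 p - q1 q) (q2 p - q2 q) (q3 p - q3 q)"

definition scaleR_quat :: "real \<Rightarrow> quat \<Rightarrow> quat" where
  "r *\<^sub>R p = Quat (r * q0 p) (r * q1 p) (r * q2 p) (r * q3 p)"

definition times_quat :: "quat \<Rightarrow> quat \<Rightarrow> quat" where
  "p * q = Quat
     (q0 p * q0 q - q1 p * q1 q - q2 p * q2 q - q3 p * q3 q)
     (q0 p * q1 q + q1 p * q0 q + q2 p * q3 q - q3 p * q2 q)
     (q0 p * q2 q - q1 p * q3 q + q2 p * q0 q + q3 p * q1 q)
     (q0 p * q3 q + q1 p * q2 q - q2 p * q1 q + q3 p * q0 q)"

instance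
  by standard
    (auto simp: quat_eq_iff zero_quat_def one_quat_def plus_quat_def uminus_quat_def
      minus_quat_def scaleR_quat_def times_quat_def algebra_simps)

end

lemma quat_sel [simp]:
  "q0 0 = 0" "q1 0 = 0" "q2 0 = 0" "q3 0 = 0"
  "q0 1 = 1" "q1 1 = 0" "q2 1 = 0" "q3 1 = 0"
  "q0 (p + q) = q0 p + q0 q" "q1 (p + q) = q1 p + q1 q"
  "q2 (p + q) = q2 p + q2 q" "q3 (p + q) = q3 p + q3 q"
  "q0 (- p) = - q0 p" "q1 (- p) = - q1 p" "q2 (- p) = - q2 p" "q3 (- p) = - q3 p"
  "q0 (p - q) = q0 p - q0 q" "q1 (p - q) = q1 p - q1 q"
  "q2 (p - q) = q2 p - q2 q" "q3 (p - q) = q3 p - q3 q"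
  "q0 (r *\<^sub>R p) = r * q0 p" "q1 (r *\<^sub>R p) = r * q1 p"
  "q2 (r *\<^sub>R p) = r * q2 p" "q3 (r *\<^sub>R p) = r * q3 p"
  by (simp_all add: zero_quat_def one_quat_def plus_quat_def uminus_quat_def
      minus_quat_def scaleR_quat_def)

lemma quat_sel_times:
  "q0 (p * q) = q0 p * q0 q - q1 p * q1 q - q2 p * q2 q - q3 p * q3 q"
  "q1 (p * q) = q0 p * q1 q + q1 p * q0 q + q2 p * q3 q - q3 p * q2 q"
  "q2 (p * q) = q0 p * q2 q - q1 p * q3 q + q2 p * q0 q + q3 p * q1 q"
  "q3 (p * q) = q0 p * q3 q + q1 p * q2 q - q2 p * q1 q + q3 p * q0 q"
  by (simp_all add: times_quat_def)

definition quat_i :: quat where "quat_i = Quat 0 1 0 0"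
definition quat_j :: quat where "quat_j = Quat 0 0 1 0"
definition quat_k :: quat where "quat_k = Quat 0 0 0 1"

lemma quat_expansion:
  "q = q0 q *\<^sub>R 1 + q1 q *\<^sub>R quat_i + q2 q *\<^sub>R quat_j + q3 q *\<^sub>R quat_k"
  by (simp add: quat_eq_iff quat_i_def quat_j_def quat_k_def)

lemma quat_relations:
  "quat_i * quat_i = -1" "quat_j * quat_j = -1" "quat_k * quat_k = -1"
  "quat_i * quat_j * quat_k = -1"
  by (simp_all add: quat_eq_iff quat_sel_times quat_i_def quat_j_def quat_k_def)

definition quat_cnj :: "quat \<Rightarrow> quat" where
  "quat_cnj q = Quat (q0 q) (- q1 q) (- q2 q) (- q3 q)"


subsection \<open>The real octonion algebra\<close>

text \<open>\<open>Oct a' a''\<close> stands for \<open>a' + a'' e\<close>.  The product is not associative, so the type is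
  made an instance of \<^class>\<open>real_vector\<close>, \<^class>\<open>times\<close> and \<^class>\<open>one\<close> only.\<close>

datatype oct = Oct (oct_fst: quat) (oct_snd: quat)

lemma oct_eq_iff: "a = b \<longleftrightarrow> oct_fst a = oct_fst b \<and> oct_snd a = oct_snd b"
  by (cases a; cases b) auto

instantiation oct :: real_vector
begin

definition zero_oct :: oct where
  "0 = Oct 0 0"

definition plus_oct :: "oct \<Rightarrow> oct \<Rightarrow> oct" where
  "a + b = Oct (oct_fst a + oct_fst b) (oct_snd a + oct_snd b)"

definition uminus_oct :: "oct \<Rightarrow> oct" where
  "- a = Oct (- oct_fst a) (- oct_snd a)"

definition minus_oct :: "oct \<Rightarrow> oct \<Rightarrow> oct" where
  "a - b = Oct (oct_fst a - oct_fst b) (oct_snd a - oct_snd b)"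

definition scaleR_oct :: "real \<Rightarrow> oct \<Rightarrow> oct" where
  "r *\<^sub>R a = Oct (r *\<^sub>R oct_fst a) (r *\<^sub>R oct_snd a)"

instance
  by standard
    (auto simp: oct_eq_iff zero_oct_def plus_oct_def uminus_oct_def minus_oct_def
      scaleR_oct_def algebra_simps)

end

instantiation oct :: "{one, times}"
begin

definition one_oct :: oct where
  "1 = Oct 1 0"

definition times_oct :: "oct \<Rightarrow> oct \<Rightarrow> oct" where
  "a * b = Oct
     (oct_fst a * oct_fst b - quat_cnj (oct_snd b) * oct_snd a)
     (oct_snd b * oct_fst a + oct_snd a * quat_cnj (oct_fst b))"

instance ..

end

lemma oct_sel [simp]:
  "oct_fst 0 = 0" "oct_snd 0 = 0" "oct_fst 1 = 1" "oct_snd 1 = 0"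
  "oct_fst (a + b) = oct_fst a + oct_fst b" "oct_snd (a + b) = oct_snd a + oct_snd b"
  "oct_fst (- a) = - oct_fst a" "oct_snd (- a) = - oct_snd a"
  "oct_fst (a - b) = oct_fst a - oct_fst b" "oct_snd (a - b) = oct_snd a - oct_snd b"
  "oct_fst (r *\<^sub>R a) = r *\<^sub>R oct_fst a" "oct_snd (r *\<^sub>R a) = r *\<^sub>R oct_snd a"
  by (simp_all add: zero_oct_def one_oct_def plus_oct_def uminus_oct_def minus_oct_def
      scaleR_oct_def)

definition oct_of_quat :: "quat \<Rightarrow> oct" where
  "oct_of_quat q = Oct q 0"

definition oct_e :: oct where
  "oct_e = Oct 0 1"

lemma oct_of_quat_times_e: "oct_of_quat q * oct_e = Oct 0 q"
proof -
  have "quat_cnj 1 = 1" "quat_cnj 0 = 0"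
    by (simp_all add: quat_cnj_def quat_eq_iff)
  then show ?thesis
    by (simp add: times_oct_def oct_of_quat_def oct_e_def)
qed

lemma Oct_eq: "Oct p q = oct_of_quat p + oct_of_quat q * oct_e"
  unfolding oct_of_quat_times_e by (simp add: oct_eq_iff oct_of_quat_def)

definition oct_basis :: "oct list" where
  "oct_basis =
     [1, oct_of_quat quat_i, oct_of_quat quat_j, oct_of_quat quat_k,
      oct_e, oct_of_quat quat_i * oct_e, oct_of_quat quat_j * oct_e, oct_of_quat quat_k * oct_e]"

definition oct_vec :: "oct \<Rightarrow> real vec" where
  "oct_vec x = vec_of_list
     [q0 (oct_fst x), q1 (oct_fst x), q2 (oct_fst x), q3 (oct_fst x),
      q0 (oct_snd x), q1 (oct_snd x), q2 (oct_snd x), q3 (oct_snd x)]"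

lemma oct_vec_carrier: "oct_vec x \<in> carrier_vec 8"
  by (intro carrier_vecI) (simp add: oct_vec_def)

lemma oct_expansion: "x = (\<Sum>n<8. (oct_vec x $ n) *\<^sub>R (oct_basis ! n))"
proof -
  have vec: "oct_vec x $ n =
      [q0 (oct_fst x), q1 (oct_fst x), q2 (oct_fst x), q3 (oct_fst x),
       q0 (oct_snd x), q1 (oct_snd x), q2 (oct_snd x), q3 (oct_snd x)] ! n" for n
    by (simp only: oct_vec_def vec_of_list_index)
  have basis: "oct_basis =
      [Oct 1 0, Oct quat_i 0, Oct quat_j 0, Oct quat_k 0,
       Oct 0 1, Oct 0 quat_i, Oct 0 quat_j, Oct 0 quat_k]"
    by (simp only: oct_basis_def oct_of_quat_times_e) (simp add: oct_of_quat_def oct_e_def one_oct_def)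
  have "{..<8} = {0, 1, 2, 3, 4, 5, 6, 7::nat}"
    by auto
  then show ?thesis
    by (simp add: vec basis oct_eq_iff quat_eq_iff quat_i_def quat_j_def quat_k_def)
qed


subsection \<open>Matrix representations\<close>

definition quat_phi :: "quat \<Rightarrow> real mat" where
  "quat_phi q = mat_of_rows_list 4
     [[q0 q, - q1 q, - q2 q, - q3 q],
      [q1 q,   q0 q, - q3 q,   q2 q],
      [q2 q,   q3 q,   q0 q, - q1 q],
      [q3 q, - q2 q,   q1 q,   q0 q]]"

definition quat_tau :: "quat \<Rightarrow> real mat" where
  "quat_tau q = mat_of_rows_list 4
     [[q0 q, - q1 q, - q2 q, - q3 q],
      [q1 q,   q0 q,   q3 q, - q2 q],
      [q2 q, - q3 q,   q0 q,   q1 q],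
      [q3 q,   q2 q, - q1 q,   q0 q]]"

definition K4 :: "real mat" where
  "K4 = mat_diag 4 (\<lambda>n. [1, -1, -1, -1] ! n)"

definition oct_omega :: "oct \<Rightarrow> real mat" where
  "oct_omega a = four_block_mat
     (quat_phi (oct_fst a))      (- (quat_tau (oct_snd a) * K4))
     (quat_phi (oct_snd a) * K4) (quat_tau (oct_fst a))"

lemma oct_omega_carrier: "oct_omega a \<in> carrier_mat 8 8"
proof -
  have "quat_phi p \<in> carrier_mat 4 4" "quat_tau p \<in> carrier_mat 4 4" for p
    by (rule carrier_matI; simp only: quat_phi_def quat_tau_def mat_of_rows_list_def dim_row_mat
        dim_col_mat list.size; simp)+
  then have "oct_omega a \<in> carrier_mat (4 + 4) (4 + 4)"
    unfolding oct_omega_def by (intro four_block_carrier_mat)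
  then show ?thesis by simp
qed

end

theory Submission
  imports Defs
begin

text \<open>
  In the product \<open>a x = (a' x' - cnj x'' a'') + (x'' a' + a'' cnj x') e\<close> each of the four
  summands multiplies a component of \<open>x\<close>, possibly conjugated, by a component of \<open>a\<close>, from the
  left or from the right.  On coordinate vectors in \<open>\<real>\<^sup>4\<close>, left multiplication by \<open>p\<close>
  acts as \<open>\<phi>(p)\<close>, right multiplication by \<open>p\<close> as \<open>\<tau>(p)\<close>, and conjugation as \<open>K\<^sub>4\<close>
  (\<open>quat_vec_mult_left\<close>, \<open>quat_vec_mult_right\<close>, \<open>quat_vec_cnj\<close>).  Hence \<open>x'\<close> and \<open>x''\<close> contribute
  \<open>\<phi>(a')\<close> and \<open>- \<tau>(a'') K\<^sub>4\<close> to the first component of \<open>a x\<close>, and \<open>\<phi>(a'') K\<^sub>4\<close> and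
  \<open>\<tau>(a')\<close> to the second; these are the four blocks of \<open>\<omega>(a)\<close>.
\<close>

definition quat_vec :: "quat \<Rightarrow> real vec" where
  "quat_vec q = vec_of_list [q0 q, q1 q, q2 q, q3 q]"

lemma quat_vec_carrier [simp]: "quat_vec q \<in> carrier_vec 4"
  by (intro carrier_vecI) (simp add: quat_vec_def)

lemma mat_of_4_rows:
  "mat_of_rows_list n [u, v, w, z] = mat 4 n (\<lambda>(i, j). [u, v, w, z] ! i ! j)"
proof -
  have "length [u, v, w, z] = 4"
    by simp
  then show ?thesis
    unfolding mat_of_rows_list_def by (simp only:)
qed

lemma quat_phi_carrier [simp]: "quat_phi p \<in> carrier_mat 4 4"
  by (simp add: quat_phi_def mat_of_4_rows)

lemma quat_tau_carrier [simp]: "quat_tau p \<in> carrier_mat 4 4"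
  by (simp add: quat_tau_def mat_of_4_rows)

lemma K4_carrier [simp]: "K4 \<in> carrier_mat 4 4"
  by (simp add: K4_def)

lemma less_4_cases: "(n::nat) < 4 \<Longrightarrow> n = 0 \<or> n = 1 \<or> n = 2 \<or> n = 3"
  by linarith

lemma atLeastLessThan_0_4: "{0..<4} = {0, 1, 2, 3::nat}"
  by auto

lemma quat_vec_index:
  "quat_vec q $ 0 = q0 q" "quat_vec q $ Suc 0 = q1 q" "quat_vec q $ 2 = q2 q" "quat_vec q $ 3 = q3 q"
  unfolding quat_vec_def by (simp_all only: vec_of_list_index) simp_all

lemma dim_quat_vec [simp]: "dim_vec (quat_vec q) = 4"
  by (simp add: quat_vec_def)

lemma quat_vec_diff: "quat_vec (p - q) = quat_vec p - quat_vec q"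
  by (rule eq_vecI) (auto dest!: less_4_cases simp: quat_vec_index)

lemma quat_vec_add: "quat_vec (p + q) = quat_vec p + quat_vec q"
  by (rule eq_vecI) (auto dest!: less_4_cases simp: quat_vec_index)

lemma quat_vec_mult_left: "quat_vec (p * q) = quat_phi p *\<^sub>v quat_vec q"
  by (rule eq_vecI)
    (auto dest!: less_4_cases simp: quat_vec_index quat_phi_def mat_of_4_rows
      scalar_prod_def atLeastLessThan_0_4 quat_sel_times)

lemma quat_vec_mult_right: "quat_vec (q * p) = quat_tau p *\<^sub>v quat_vec q"
  by (rule eq_vecI)
    (auto dest!: less_4_cases simp: quat_vec_index quat_tau_def mat_of_4_rows
      scalar_prod_def atLeastLessThan_0_4 quat_sel_times)

lemma quat_vec_cnj: "quat_vec (quat_cnj q) = K4 *\<^sub>v quat_vec q"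
  by (rule eq_vecI)
    (auto dest!: less_4_cases simp: quat_vec_index K4_def mat_diag_def
      scalar_prod_def atLeastLessThan_0_4 quat_cnj_def)

lemma oct_vec_append: "oct_vec x = quat_vec (oct_fst x) @\<^sub>v quat_vec (oct_snd x)"
  by (simp add: oct_vec_def quat_vec_def)

theorem theorem2p1:
  fixes a x :: oct
  shows "oct_vec (a * x) = oct_omega a *\<^sub>v oct_vec x"
proof -
  obtain a' a'' where a: "a = Oct a' a''" by (cases a)
  obtain x' x'' where x: "x = Oct x' x''" by (cases x)
  have "quat_vec (a' * x' - quat_cnj x'' * a'')
      = quat_phi a' *\<^sub>v quat_vec x' - quat_tau a'' *\<^sub>v (K4 *\<^sub>v quat_vec x'')"
    by (simp add: quat_vec_diff quat_vec_mult_left[of a'] quat_vec_mult_right[of _ a''] quat_vec_cnj)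
  also have "\<dots> = quat_phi a' *\<^sub>v quat_vec x' + (- (quat_tau a'' * K4)) *\<^sub>v quat_vec x''"
    by (simp add: carrier_matD[OF K4_carrier] assoc_mult_mat_vec[of _ 4 4 _ 4]
        minus_add_uminus_vec[of _ 4] mult_mat_vec_carrier[of _ 4 4])
  finally have fst: "quat_vec (a' * x' - quat_cnj x'' * a'')
      = quat_phi a' *\<^sub>v quat_vec x' + (- (quat_tau a'' * K4)) *\<^sub>v quat_vec x''" .
  have "quat_vec (x'' * a' + a'' * quat_cnj x')
      = quat_tau a' *\<^sub>v quat_vec x'' + quat_phi a'' *\<^sub>v (K4 *\<^sub>v quat_vec x')"
    by (simp add: quat_vec_add quat_vec_mult_left[of a''] quat_vec_mult_right[of _ a'] quat_vec_cnj)
  also have "\<dots> = (quat_phi a'' * K4) *\<^sub>v quat_vec x' + quat_tau a' *\<^sub>v quat_vec x''"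
    by (simp add: assoc_mult_mat_vec[of _ 4 4 _ 4] comm_add_vec[of _ 4] mult_mat_vec_carrier[of _ 4 4])
  finally have snd: "quat_vec (x'' * a' + a'' * quat_cnj x')
      = (quat_phi a'' * K4) *\<^sub>v quat_vec x' + quat_tau a' *\<^sub>v quat_vec x''" .
  show ?thesis
    unfolding a x oct_vec_append oct_omega_def times_oct_def oct.sel fst snd
    by (rule four_block_mat_mult_vec[of _ 4 4 _ 4 _ 4, symmetric])
      (simp_all add: uminus_carrier_iff_mat mult_carrier_mat[of _ 4 4 _ 4])
qed

end
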